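(* Let $n,m_1,m_2$ be nonnegative integers. Let $C_1(m_1,m_2,n)$ be the number of partitions of $n$ into parts congruent to $0,1,3,$ or $5\pmod 6$ with exactly $m_1$ parts congruent to $1\pmod 6$ and exactly $m_2$ parts congruent to $5\pmod 6$. Let $C_2(m_1,m_2,n)$ be the number of partitions of $n$ satisfying: (a) if two adjacent parts differ by exactly $1$, the smaller is not $\equiv1\pmod3$; (b) if two adjacent parts differ by exactly $2$, the smaller is $\equiv2\pmod3$; (c) no part equals $2$; (d) there are exactly $m_1$ parts congruent to $1\pmod 3$ and exactly $m_2$ parts congruent to $2\pmod 3$. Then $C_1(m_1,m_2,n)=C_2(m_1,m_2,n)$.
   Context: Partitions are written in nonincreasing order; "adjacent parts" means $\lambda_j$ and $\lambda_{j+1}$ in that ordering. Numbers of parts in a residue class are counted with multiplicity. *)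

theory Defs
  imports Main
begin

definition is_partition :: "nat \<Rightarrow> nat list \<Rightarrow> bool" where
  "is_partition n ps \<longleftrightarrow> sorted_wrt (\<ge>) ps \<and> (\<forall>p\<in>set ps. 0 < p) \<and> sum_list ps = n"

definition num_parts_mod :: "nat \<Rightarrow> nat \<Rightarrow> nat list \<Rightarrow> nat" where
  "num_parts_mod m r ps = length (filter (\<lambda>p. p mod m = r) ps)"

definition C1 :: "nat \<Rightarrow> nat \<Rightarrow> nat \<Rightarrow> nat" where
  "C1 m1 m2 n = card {ps. is_partition n ps
      \<and> (\<forall>p\<in>set ps. p mod 6 \<in> {0, 1, 3, 5})
      \<and> num_parts_mod 6 1 ps = m1 \<and> num_parts_mod 6 5 ps = m2}"

definition C2 :: "nat \<Rightarrow> nat \<Rightarrow> nat \<Rightarrow> nat" where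
  "C2 m1 m2 n = card {ps. is_partition n ps
      \<and> (\<forall>j. Suc j < length ps \<longrightarrow>
            (ps!j = ps!(Suc j) + 1 \<longrightarrow> ps!(Suc j) mod 3 \<noteq> 1)
          \<and> (ps!j = ps!(Suc j) + 2 \<longrightarrow> ps!(Suc j) mod 3 = 2))
      \<and> 2 \<notin> set ps
      \<and> num_parts_mod 3 1 ps = m1 \<and> num_parts_mod 3 2 ps = m2}"

end

theory Submission
  imports Defs "HOL-Library.Multiset"
begin

text \<open>
  Write every part as \<open>3 k + \<epsilon>\<close> with \<open>\<epsilon> \<in> {-1, 0, 1}\<close>. Read from the smallest part upwards and
  started at a virtual part \<open>0\<close>, the conditions (a)--(c) say that \<open>k\<close> is nondecreasing and increases by at
  least \<open>d = 2\<close> wherever \<open>\<epsilon>\<close> descends. Subtracting these forced jumps from the \<open>k\<close>'s splits such a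
  partition into a word in the letters \<open>\<epsilon>\<close>, weighted by \<open>d\<close> times a comajor index, and an arbitrary
  partition. On the other side, a partition into parts \<open>3 j\<close>, \<open>3 d k + 1\<close> and \<open>3 d k - 1\<close> splits into
  a pair of multisets, weighted by \<open>d\<close> times their sum, and an arbitrary partition. For \<open>d = 1\<close> both
  conditions are void, so both sides count the same partitions; cancelling the arbitrary partition
  from this identity shows that words and pairs of multisets are equidistributed, and hence the two
  sides agree for every \<open>d \<ge> 1\<close>.
\<close>

section \<open>Counting tools: convolutions, multisets and padding by zeros\<close>

lemma le_of_mult_le: "0 < d \<Longrightarrow> d * c \<le> K \<Longrightarrow> c \<le> K" for c d K :: nat
  by (cases d) auto

text \<open>Fibring the pairs over \<open>c = f s\<close> leaves products of finite sets. This
  extracts the coefficient of q^K in F(q^d) G(q), with F and G the generating functions of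
  \<open>f\<close> and \<open>g\<close>.\<close>

lemma card_weighted_pairs:
  fixes f :: "'a \<Rightarrow> nat" and g :: "'b \<Rightarrow> nat"
  assumes d: "0 < d"
    and fin: "\<And>c. finite {s \<in> S. f s = c}" "\<And>j. finite {t \<in> T. g t = j}"
  shows "card {(s, t). s \<in> S \<and> t \<in> T \<and> d * f s + g t = K} =
    (\<Sum>c | d * c \<le> K. card {s \<in> S. f s = c} * card {t \<in> T. g t = K - d * c})"
proof -
  have finI: "finite {c. d * c \<le> K}"
  proof (rule finite_subset)
    show "{c. d * c \<le> K} \<subseteq> {..K}"
      using le_of_mult_le[OF d] by auto
  qed simp
  have "{(s, t). s \<in> S \<and> t \<in> T \<and> d * f s + g t = K} =
    (\<Union>c\<in>{c. d * c \<le> K}. {s \<in> S. f s = c} \<times> {t \<in> T. g t = K - d * c})"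
    by auto
  also have "card \<dots> =
    (\<Sum>c | d * c \<le> K. card ({s \<in> S. f s = c} \<times> {t \<in> T. g t = K - d * c}))"
    by (rule card_UN_disjoint) (use finI fin in auto)
  finally show ?thesis by (simp add: card_cartesian_product)
qed

text \<open>With \<open>p 0 = 1\<close> the system is triangular: the term \<open>c = k\<close>
  isolates \<open>u k\<close>, and all earlier terms agree by induction. The bound \<open>n\<close>
  is there because the convolutions will be compared only up to a fixed weight.\<close>

lemma convolution_cancel:
  fixes u v p :: "nat \<Rightarrow> nat"
  assumes "p 0 = 1"
    and "\<And>k. k \<le> n \<Longrightarrow> (\<Sum>c\<le>k. u c * p (k - c)) = (\<Sum>c\<le>k. v c * p (k - c))"
    and "k \<le> n"
  shows "u k = v k"
  using assms(3)
proof (induction k rule: less_induct)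
  case (less k)
  have "(\<Sum>c<k. u c * p (k - c)) = (\<Sum>c<k. v c * p (k - c))"
    using less by (intro sum.cong) auto
  moreover have "(\<Sum>c\<le>k. w c * p (k - c)) = (\<Sum>c<k. w c * p (k - c)) + w k" for w
    using assms(1) by (simp flip: lessThan_Suc_atMost)
  ultimately show ?case
    using assms(2)[OF less.prems] by simp
qed

lemma card_desc_lists_mset:
  fixes Q :: "'a::linorder multiset \<Rightarrow> bool"
  shows "card {ps. sorted_wrt (\<ge>) ps \<and> Q (mset ps)} = card {M. Q M}"
proof (rule bij_betw_same_card[where f = mset],
    rule bij_betw_byWitness[where f' = "\<lambda>M. rev (sorted_list_of_multiset M)"])
  show "\<forall>ps\<in>{ps. sorted_wrt (\<ge>) ps \<and> Q (mset ps)}. rev (sorted_list_of_multiset (mset ps)) = ps"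
  proof clarify
    fix ps :: "'a list" assume "sorted_wrt (\<ge>) ps"
    then have "sorted (rev ps)" by (simp add: sorted_wrt_rev)
    then have "sorted_list_of_multiset (mset ps) = rev ps"
      by (metis mset_rev sorted_list_of_multiset_mset sorted_sort_id)
    then show "rev (sorted_list_of_multiset (mset ps)) = ps" by simp
  qed
qed (auto simp: sorted_wrt_rev)

text \<open>The zeros of a nonincreasing list form its tail. A condition blind to trailing zeros can
  therefore be counted on lists of one fixed length, which is what the decomposition into words of
  fixed length requires.\<close>

lemma card_pad_zeros:
  fixes Q :: "nat list \<Rightarrow> bool"
  assumes pad: "\<And>ps m. Q (ps @ replicate m 0) \<longleftrightarrow> Q ps"
    and len: "\<And>ps. 0 \<notin> set ps \<Longrightarrow> Q ps \<Longrightarrow> length ps \<le> N"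
  shows "card {ps. sorted_wrt (\<ge>) ps \<and> 0 \<notin> set ps \<and> Q ps} =
    card {xs. sorted_wrt (\<ge>) xs \<and> length xs = N \<and> Q xs}"
proof (rule bij_betw_same_card[where f = "\<lambda>ps. ps @ replicate (N - length ps) 0"],
    rule bij_betw_byWitness[where f' = "filter (\<lambda>x. x \<noteq> 0)"])
  have strip: "\<exists>m. xs = filter (\<lambda>x. x \<noteq> 0) xs @ replicate m 0 \<and>
      length xs = length (filter (\<lambda>x. x \<noteq> 0) xs) + m"
    if "sorted_wrt (\<ge>) xs" for xs :: "nat list"
    using that
  proof (induction xs)
    case (Cons x xs)
    show ?case
    proof (cases "x = 0")
      case True
      then have "\<forall>y\<in>set xs. y = 0" using Cons.prems by auto
      then have "filter (\<lambda>x. x \<noteq> 0) xs = []" "replicate (length xs) 0 = xs"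
        by (auto simp: replicate_length_same)
      then show ?thesis using True by (intro exI[of _ "Suc (length xs)"]) auto
    qed (use Cons in auto)
  qed simp
  show "\<forall>xs\<in>{xs. sorted_wrt (\<ge>) xs \<and> length xs = N \<and> Q xs}.
    filter (\<lambda>x. x \<noteq> 0) xs @ replicate (N - length (filter (\<lambda>x. x \<noteq> 0) xs)) 0 = xs"
    using strip by (metis (mono_tags, lifting) add_diff_cancel_left' mem_Collect_eq)
  show "filter (\<lambda>x. x \<noteq> 0) ` {xs. sorted_wrt (\<ge>) xs \<and> length xs = N \<and> Q xs}
    \<subseteq> {ps. sorted_wrt (\<ge>) ps \<and> 0 \<notin> set ps \<and> Q ps}"
    using strip pad by (auto simp: sorted_wrt_filter) metis
  show "\<forall>ps\<in>{ps. sorted_wrt (\<ge>) ps \<and> 0 \<notin> set ps \<and> Q ps}.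
    filter (\<lambda>x. x \<noteq> 0) (ps @ replicate (N - length ps) 0) = ps"
  proof (intro ballI)
    fix ps assume "ps \<in> {ps. sorted_wrt (\<ge>) ps \<and> 0 \<notin> set ps \<and> Q ps}"
    then have "filter (\<lambda>x. x \<noteq> 0) ps = ps" by (intro filter_True) (auto intro: ccontr)
    then show "filter (\<lambda>x. x \<noteq> 0) (ps @ replicate (N - length ps) 0) = ps" by simp
  qed
  have "sorted_wrt (\<ge>) (replicate m (0::nat))" for m
    by (induction m) auto
  then show "(\<lambda>ps. ps @ replicate (N - length ps) 0) `
      {ps. sorted_wrt (\<ge>) ps \<and> 0 \<notin> set ps \<and> Q ps}
    \<subseteq> {xs. sorted_wrt (\<ge>) xs \<and> length xs = N \<and> Q xs}"
    using len pad by (auto simp: sorted_wrt_append)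
qed

lemma length_le_sum_list:
  fixes ps :: "nat list"
  assumes "0 \<notin> set ps"
  shows "length ps \<le> sum_list ps"
  using assms by (induction ps) auto

lemma sorted_desc_Cons_iff:
  fixes x :: nat
  shows "sorted_wrt (\<ge>) (x # xs) \<longleftrightarrow> hd (xs @ [0]) \<le> x \<and> sorted_wrt (\<ge>) xs"
  by (cases xs) auto

section \<open>Blocks, letters and the removal of forced jumps\<close>

text \<open>
  In \<open>x = 3 k + \<epsilon>\<close>, \<open>block x\<close> is \<open>k\<close> and \<open>letter x\<close> is \<open>\<epsilon> + 1\<close>, so the neutral letter is \<open>1\<close>. Lists
  are ordered from the largest part down; \<open>hd (xs @ [0])\<close> and \<open>hd (w @ [1])\<close> supply the virtual
  smallest part \<open>0\<close> and its letter.
\<close>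

definition block :: "nat \<Rightarrow> nat" where
  "block x = (x + 1) div 3"

definition letter :: "nat \<Rightarrow> nat" where
  "letter x = (x + 1) mod 3"

fun spaced :: "nat \<Rightarrow> nat list \<Rightarrow> bool" where
  "spaced d [] \<longleftrightarrow> True"
| "spaced d (x # xs) \<longleftrightarrow>
    block (hd (xs @ [0])) + d * of_bool (letter x < letter (hd (xs @ [0]))) \<le> block x \<and> spaced d xs"

fun des :: "nat list \<Rightarrow> nat" where
  "des [] = 0"
| "des (e # w) = des w + of_bool (e < hd (w @ [1]))"

text \<open>A descent at position i, counted from 1 at the largest part, lies in i suffixes and
  contributes i. This matches the jump it forces, which raises the blocks of exactly those i
  parts.\<close>

fun comaj :: "nat list \<Rightarrow> nat" where
  "comaj [] = 0"
| "comaj (e # w) = des (e # w) + comaj w"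

fun excess :: "nat \<Rightarrow> nat list \<Rightarrow> nat list" where
  "excess d [] = []"
| "excess d (x # xs) = (block x - d * des (map letter (x # xs))) # excess d xs"

text \<open>
  The truncated subtraction below is harmless: a word starting with the letter \<open>0\<close> has a descent
  (\<open>des_pos_or_hd_pos\<close>).
\<close>

fun assemble :: "nat \<Rightarrow> nat list \<Rightarrow> nat list \<Rightarrow> nat list" where
  "assemble d (e # w) (p # ps) = (3 * (p + d * des (e # w)) + e - 1) # assemble d w ps"
| "assemble d _ _ = []"

text \<open>By the shift in \<open>letter\<close>, the letter \<open>2\<close> marks parts congruent
  to 1 modulo 3 and \<open>0\<close> marks parts congruent to 2; hence \<open>a\<close> and
  \<open>b\<close> are the two prescribed multiplicities.\<close>

definition words :: "nat \<Rightarrow> nat \<Rightarrow> nat \<Rightarrow> nat list set" where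
  "words N a b = {w. length w = N \<and> set w \<subseteq> {0, 1, 2} \<and> count_list w 2 = a \<and> count_list w 0 = b}"

lemma block_0 [simp]: "block 0 = 0"
  by (simp add: block_def)

lemma letter_0 [simp]: "letter 0 = 1"
  by (simp add: letter_def)

lemma block_letter: "3 * block x + letter x = x + 1"
  by (simp add: block_def letter_def)

lemma letter_le: "letter x \<le> 2"
  by (simp add: letter_def flip: less_Suc_eq_le)

lemma hd_map_letter: "hd (map letter xs @ [Suc 0]) = letter (hd (xs @ [0]))"
  by (cases xs) auto

lemma block_letter_unique:
  assumes "e \<le> 2" "1 \<le> m + e"
  shows "block (3 * m + e - 1) = m" "letter (3 * m + e - 1) = e"
proof -
  have "3 * m + e - 1 + 1 = 3 * m + e" using assms by simp
  then show "block (3 * m + e - 1) = m" "letter (3 * m + e - 1) = e"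
    unfolding block_def letter_def using assms(1) by (simp_all only:) auto
qed

text \<open>A drop of letters lowers a part by at most 2, while the block step that it forces raises
  it by at least 3.\<close>

lemma spaced_imp_sorted:
  assumes "0 < d" "spaced d xs"
  shows "sorted_wrt (\<ge>) xs"
  using assms(2)
proof (induction xs)
  case (Cons x xs)
  let ?y = "hd (xs @ [0])"
  have "block ?y + d * of_bool (letter x < letter ?y) \<le> block x" using Cons.prems by simp
  then have "?y \<le> x"
    using \<open>0 < d\<close> block_letter[of x] block_letter[of ?y] letter_le[of ?y]
    by (cases "letter x < letter ?y") auto
  then show ?case using Cons unfolding sorted_desc_Cons_iff by simp
qed simp

text \<open>If \<open>?y \<le> x\<close>, the block cannot decrease, and if the letter drops the
  block has to increase by at least 1. So order alone gives the spacing with jump 1.\<close>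

lemma sorted_imp_spaced_1:
  assumes "sorted_wrt (\<ge>) xs"
  shows "spaced 1 xs"
  using assms
proof (induction xs)
  case (Cons x xs)
  let ?y = "hd (xs @ [0])"
  have "?y \<le> x" using Cons.prems unfolding sorted_desc_Cons_iff by simp
  then have "block ?y + of_bool (letter x < letter ?y) \<le> block x"
    using block_letter[of x] block_letter[of ?y] letter_le[of x] letter_le[of ?y]
    by (cases "letter x < letter ?y") auto
  then show ?case using Cons by (simp del: of_bool_eq_iff)
qed simp

text \<open>Trailing zeros are copies of the virtual part: they have block \<open>0\<close> and the
  neutral letter, so they create no descent.\<close>

lemma spaced_pad: "spaced d (ps @ replicate m 0) \<longleftrightarrow> spaced d ps"
proof -
  have hd: "hd ((ps @ replicate m 0) @ [0]) = hd (ps @ [0])" for ps :: "nat list"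
    by (cases ps; cases m) auto
  have "spaced d (replicate m 0)"
    by (induction m) (use hd[of "[]"] in \<open>auto simp: hd_append\<close>)
  then show ?thesis
    by (induction ps) (use hd in auto)
qed

text \<open>The forced jumps accumulate from the virtual part upwards. This makes the natural-number
  subtraction in \<open>excess\<close> exact.\<close>

lemma spaced_des_le: "spaced d xs \<Longrightarrow> d * des (map letter xs) \<le> block (hd (xs @ [0]))"
  by (induction xs) (auto simp: hd_map_letter algebra_simps)

lemma hd_excess: "hd (excess d xs @ [0]) = block (hd (xs @ [0])) - d * des (map letter xs)"
  by (cases xs) auto

lemma sorted_excess: "spaced d xs \<Longrightarrow> sorted_wrt (\<ge>) (excess d xs)"
proof (induction xs)
  case (Cons x xs)
  then show ?case
    using spaced_des_le[of d xs] unfolding excess.simps sorted_desc_Cons_iff hd_excess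
    by (auto simp: hd_map_letter algebra_simps)
qed simp

lemma length_excess [simp]: "length (excess d xs) = length xs"
  by (induction xs) auto

lemma sum_list_block:
  "spaced d xs \<Longrightarrow> sum_list (map block xs) = d * comaj (map letter xs) + sum_list (excess d xs)"
proof (induction xs)
  case (Cons x xs)
  then show ?case
    using spaced_des_le[OF Cons.prems] by (auto simp: algebra_simps)
qed simp

lemma assemble_excess: "spaced d xs \<Longrightarrow> assemble d (map letter xs) (excess d xs) = xs"
proof (induction xs)
  case (Cons x xs)
  have "d * des (letter x # map letter xs) \<le> block x"
    using spaced_des_le[OF Cons.prems] by simp
  then have "3 * (block x - d * des (letter x # map letter xs) + d * des (letter x # map letter xs))
      + letter x - 1 = x"
    using block_letter[of x] by simp
  then show ?case using Cons by (simp del: des.simps)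
qed simp

text \<open>Reading upwards from the virtual letter \<open>1\<close>, a word cannot arrive at the
  letter \<open>0\<close> without a descent on the way.\<close>

lemma des_pos_or_hd_pos: "1 \<le> des w + hd (w @ [1])"
  by (induction w) auto

text \<open>The conjunct on the block of the head strengthens the induction: it is what the spacing
  of a new part is compared with.\<close>

lemma assemble_inverse:
  assumes "0 < d" "length w = length ps" "set w \<subseteq> {0, 1, 2}"
  shows "map letter (assemble d w ps) = w \<and> excess d (assemble d w ps) = ps \<and>
    (sorted_wrt (\<ge>) ps \<longrightarrow> spaced d (assemble d w ps)) \<and>
    block (hd (assemble d w ps @ [0])) = hd (ps @ [0]) + d * des w"
  using assms(2,3)
proof (induction w ps rule: list_induct2)
  case (Cons e w p ps)
  let ?m = "p + d * des (e # w)"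
  let ?x = "3 * ?m + e - 1"
  let ?xs = "assemble d w ps"
  have IH: "map letter ?xs = w" "excess d ?xs = ps" "sorted_wrt (\<ge>) ps \<longrightarrow> spaced d ?xs"
      "block (hd (?xs @ [0])) = hd (ps @ [0]) + d * des w"
    using Cons by auto
  have "e \<le> 2" using Cons.prems by auto
  moreover have "1 \<le> ?m + e"
    using des_pos_or_hd_pos[of "e # w"] \<open>0 < d\<close> by (cases "e = 0") (auto simp del: des.simps simp: Suc_le_eq)
  ultimately have x: "block ?x = ?m" "letter ?x = e"
    by (rule block_letter_unique)+
  have hdw: "letter (hd (?xs @ [0])) = hd (w @ [1])"
    using IH(1) hd_map_letter[of ?xs] by simp
  have "spaced d (?x # ?xs)" if "sorted_wrt (\<ge>) (p # ps)"
  proof -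
    have "hd (ps @ [0]) \<le> p" "sorted_wrt (\<ge>) ps"
      using that unfolding sorted_desc_Cons_iff by auto
    then show ?thesis using IH(3,4) x hdw by (simp add: algebra_simps)
  qed
  moreover have "excess d (?x # ?xs) = p # ps" using x IH by simp
  moreover have "map letter (?x # ?xs) = e # w" using x IH by simp
  ultimately show ?case using x by (simp del: des.simps excess.simps spaced.simps)
qed simp

lemma num_parts_mod_letter:
  "num_parts_mod 3 1 xs = count_list (map letter xs) 2"
  "num_parts_mod 3 2 xs = count_list (map letter xs) 0"
proof -
  have "x mod 3 = 1 \<longleftrightarrow> letter x = 2" "x mod 3 = 2 \<longleftrightarrow> letter x = 0" for x
    unfolding letter_def by presburger+
  then show "num_parts_mod 3 1 xs = count_list (map letter xs) 2"
    "num_parts_mod 3 2 xs = count_list (map letter xs) 0"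
    unfolding num_parts_mod_def by (induction xs) auto
qed

text \<open>Part by part, 3 k + 1 exceeds three times its block by 1 and 3 k - 1 falls short by 1.
  Once the two multiplicities are fixed, the sum of the parts and the sum of the blocks determine
  each other.\<close>

lemma sum_list_block_residues:
  "sum_list ps + num_parts_mod 3 2 ps = 3 * sum_list (map block ps) + num_parts_mod 3 1 ps"
proof (induction ps)
  case (Cons x ps)
  have "x + of_bool (x mod 3 = 2) = 3 * block x + of_bool (x mod 3 = 1)"
    unfolding block_def by (simp split: if_splits) presburger
  then show ?case using Cons by (auto simp: num_parts_mod_def)
qed (simp add: num_parts_mod_def)

section \<open>Counting spaced partitions by words and partitions\<close>

definition desc_lists :: "nat \<Rightarrow> nat list set" where
  "desc_lists N = {xs. sorted_wrt (\<ge>) xs \<and> length xs = N}"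

definition spaced_parts :: "nat \<Rightarrow> nat \<Rightarrow> nat \<Rightarrow> nat \<Rightarrow> nat list set" where
  "spaced_parts d a b K = {ps. sorted_wrt (\<ge>) ps \<and> 0 \<notin> set ps \<and> spaced d ps \<and>
    num_parts_mod 3 1 ps = a \<and> num_parts_mod 3 2 ps = b \<and> sum_list (map block ps) = K}"

text \<open>The parts are 3 j, 3 d k + 1 and 3 d k - 1. For \<open>d = 2\<close> these are the
  residues 0, 1, 3, 5 modulo 6; for \<open>d = 1\<close> the divisibility condition is void.\<close>

definition scaled_parts :: "nat \<Rightarrow> nat \<Rightarrow> nat \<Rightarrow> nat \<Rightarrow> nat list set" where
  "scaled_parts d a b K = {ps. sorted_wrt (\<ge>) ps \<and> 0 \<notin> set ps \<and>
    (\<forall>x\<in>set ps. x mod 3 = 0 \<or> d dvd block x) \<and>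
    num_parts_mod 3 1 ps = a \<and> num_parts_mod 3 2 ps = b \<and> sum_list (map block ps) = K}"

lemma card_spaced_parts_pairs:
  assumes "0 < d" "3 * K + a \<le> N"
  shows "card (spaced_parts d a b K) =
    card {(w, p). w \<in> words N a b \<and> p \<in> desc_lists N \<and> d * comaj w + sum_list p = K}"
proof -
  define Q where "Q xs \<longleftrightarrow> spaced d xs \<and>
    num_parts_mod 3 1 xs = a \<and> num_parts_mod 3 2 xs = b \<and> sum_list (map block xs) = K" for xs
  have "card (spaced_parts d a b K) = card {ps. sorted_wrt (\<ge>) ps \<and> 0 \<notin> set ps \<and> Q ps}"
    by (simp add: spaced_parts_def Q_def)
  also have "\<dots> = card {xs. sorted_wrt (\<ge>) xs \<and> length xs = N \<and> Q xs}"
  proof (rule card_pad_zeros)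
    show "Q (ps @ replicate m 0) \<longleftrightarrow> Q ps" for ps m
      by (simp add: Q_def spaced_pad num_parts_mod_def sum_list_replicate)
    \<comment> \<open>The parts sum to 3 K + a - b, and positive parts are no more numerous than
      their sum.\<close>
    show "length ps \<le> N" if "0 \<notin> set ps" "Q ps" for ps
      using length_le_sum_list[OF that(1)] that(2) sum_list_block_residues[of ps] assms(2)
      by (simp add: Q_def)
  qed
  also have "\<dots> = card {(w, p). w \<in> words N a b \<and> p \<in> desc_lists N \<and> d * comaj w + sum_list p = K}"
  proof (rule bij_betw_same_card[where f = "\<lambda>xs. (map letter xs, excess d xs)"],
      rule bij_betw_byWitness[where f' = "\<lambda>(w, p). assemble d w p"])
    show "\<forall>xs\<in>{xs. sorted_wrt (\<ge>) xs \<and> length xs = N \<and> Q xs}.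
        (case (map letter xs, excess d xs) of (w, p) \<Rightarrow> assemble d w p) = xs"
      by (auto simp: Q_def assemble_excess)
    show "\<forall>z\<in>{(w, p). w \<in> words N a b \<and> p \<in> desc_lists N \<and> d * comaj w + sum_list p = K}.
        (map letter (case z of (w, p) \<Rightarrow> assemble d w p),
         excess d (case z of (w, p) \<Rightarrow> assemble d w p)) = z"
      using assemble_inverse[OF assms(1)] by (auto simp: words_def desc_lists_def)
    have "letter x \<in> {0, 1, 2}" for x using letter_le[of x] by auto
    then show "(\<lambda>xs. (map letter xs, excess d xs)) ` {xs. sorted_wrt (\<ge>) xs \<and> length xs = N \<and> Q xs}
        \<subseteq> {(w, p). w \<in> words N a b \<and> p \<in> desc_lists N \<and> d * comaj w + sum_list p = K}"
      by (force simp: Q_def words_def desc_lists_def sorted_excess num_parts_mod_letter[simplified]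
          simp flip: sum_list_block)
    show "(\<lambda>(w, p). assemble d w p) `
        {(w, p). w \<in> words N a b \<and> p \<in> desc_lists N \<and> d * comaj w + sum_list p = K}
        \<subseteq> {xs. sorted_wrt (\<ge>) xs \<and> length xs = N \<and> Q xs}"
    proof -
      have "sorted_wrt (\<ge>) (assemble d w p) \<and> length (assemble d w p) = N \<and> Q (assemble d w p)"
        if w: "w \<in> words N a b" and p: "p \<in> desc_lists N" and K: "d * comaj w + sum_list p = K"
        for w p
      proof -
        let ?xs = "assemble d w p"
        have *: "map letter ?xs = w" "excess d ?xs = p" "spaced d ?xs"
          using assemble_inverse[OF assms(1), of w p] w p by (auto simp: words_def desc_lists_def)
        have "length ?xs = N"
          using arg_cong[OF *(1), of length] w by (simp add: words_def)
        then show ?thesis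
          using * w spaced_imp_sorted[OF assms(1) *(3)] sum_list_block[OF *(3)] K
          by (simp add: Q_def num_parts_mod_letter[simplified] words_def)
      qed
      then show ?thesis by clarsimp
    qed
  qed
  finally show ?thesis .
qed

lemma card_spaced_parts:
  assumes "0 < d" "3 * K + a \<le> N"
  shows "card (spaced_parts d a b K) = (\<Sum>c | d * c \<le> K.
    card {w \<in> words N a b. comaj w = c} * card {p \<in> desc_lists N. sum_list p = K - d * c})"
  unfolding card_spaced_parts_pairs[OF assms]
proof (rule card_weighted_pairs[OF assms(1)])
  show "finite {w \<in> words N a b. comaj w = c}" for c
    by (rule finite_subset[OF _ finite_lists_length_eq[of "{0, 1, 2}" N]]) (auto simp: words_def)
  show "finite {p \<in> desc_lists N. sum_list p = j}" for j
    by (rule finite_subset[OF _ finite_lists_length_eq[of "{..j}" N]])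
      (auto simp: desc_lists_def member_le_sum_list)
qed

section \<open>Counting scaled partitions by pairs of multisets and partitions\<close>

text \<open>The entries are the levels k of the parts 3 d k + 1 and 3 d k - 1. Level 0 gives the
  part 1 in the first family and no part in the second.\<close>

definition bounded_pairs :: "nat \<Rightarrow> nat \<Rightarrow> (nat multiset \<times> nat multiset) set" where
  "bounded_pairs a b = {(M, N). size M = a \<and> size N = b \<and> 0 \<notin># N}"

text \<open>Zeros do not change the sum, so finiteness rests on the bound on the size as
  well.\<close>

lemma finite_multisets_sum_le: "finite {M :: nat multiset. size M \<le> m \<and> sum_mset M \<le> j}"
proof (rule finite_subset)
  show "{M :: nat multiset. size M \<le> m \<and> sum_mset M \<le> j} \<subseteq>
      mset ` {xs. set xs \<subseteq> {..j} \<and> length xs \<le> m}"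
  proof
    fix M :: "nat multiset"
    assume M: "M \<in> {M. size M \<le> m \<and> sum_mset M \<le> j}"
    obtain xs where "M = mset xs" by (metis ex_mset)
    moreover from this have "set xs \<subseteq> {..j}" "length xs \<le> m"
      using M member_le_sum_list[of _ xs] by (auto simp: sum_mset_sum_list intro: le_trans)
    ultimately show "M \<in> mset ` {xs. set xs \<subseteq> {..j} \<and> length xs \<le> m}" by blast
  qed
qed (simp add: finite_lists_length_le)

lemma size_le_sum_mset:
  fixes M :: "nat multiset"
  assumes "0 \<notin># M"
  shows "size M \<le> sum_mset M"
  using assms by (induction M) auto

lemma sum_mset_image_mult: "sum_mset (image_mset (\<lambda>k. c * k) M) = c * sum_mset M" for c :: nat
  by (induction M) (auto simp: algebra_simps)

text \<open>Parts are separated by their residue modulo 3. Since 3 d k + 1, 3 d k - 1 and 3 k have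
  blocks d k, d k and k, the weight is \<open>d\<close> times the sum of the levels plus the size of
  a free partition.\<close>

lemma card_scaled_parts_pairs:
  assumes d: "0 < d"
  shows "card (scaled_parts d a b K) = card {(s, t). s \<in> bounded_pairs a b \<and> t \<in> {M. 0 \<notin># M} \<and>
    d * (sum_mset (fst s) + sum_mset (snd s)) + sum_mset t = K}"
    (is "_ = card ?R")
proof -
  define res where "res r = filter_mset (\<lambda>x. x mod 3 = r)" for r :: nat
  define up where "up k = 3 * (d * k) + 1" for k
  \<comment> \<open>\<open>dn 0\<close> is truncated to \<open>0\<close>, which lies in the wrong
    residue class; hence the condition that \<open>0\<close> is absent from the second multiset in
    the claims about \<open>join\<close>.\<close>
  define dn where "dn k = 3 * (d * k) - 1" for k
  define lev where "lev x = block x div d" for x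
  define Q where "Q M \<longleftrightarrow> 0 \<notin># M \<and> (\<forall>x\<in>#M. x mod 3 = 0 \<or> d dvd block x) \<and>
    size (res 1 M) = a \<and> size (res 2 M) = b \<and> sum_mset (image_mset block M) = K" for M
  have up: "block (up k) = d * k" "lev (up k) = k" "up k mod 3 = 1" "up k \<noteq> 0" for k
  proof -
    show "block (up k) = d * k" "up k mod 3 = 1" "up k \<noteq> 0"
      by (simp_all add: up_def block_def)
    then show "lev (up k) = k" using d by (simp add: lev_def)
  qed
  have dn: "block (dn k) = d * k" "lev (dn k) = k" "dn k mod 3 = 2" "dn k \<noteq> 0" if "k \<noteq> 0" for k
  proof -
    have "d * k \<noteq> 0" using d that by simp
    then obtain m where m: "d * k = Suc m" using not0_implies_Suc by blast
    have "dn k = 3 * m + 2" by (simp add: dn_def m)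
    then show "block (dn k) = d * k" "dn k mod 3 = 2" "dn k \<noteq> 0"
      unfolding block_def m by presburger+
    then show "lev (dn k) = k" using d by (simp add: lev_def)
  qed
  have up_lev: "up (lev x) = x" if "x mod 3 = 1" "d dvd block x" for x
  proof -
    have "d * lev x = block x" using that by (simp add: lev_def)
    then show ?thesis using that(1) unfolding up_def block_def by presburger
  qed
  have dn_lev: "dn (lev x) = x" "lev x \<noteq> 0" if "x mod 3 = 2" "d dvd block x" for x
  proof -
    have *: "d * lev x = block x" using that by (simp add: lev_def)
    then show "dn (lev x) = x" using that(1) unfolding dn_def block_def by presburger
    have "block x \<noteq> 0" using that(1) unfolding block_def by presburger
    then show "lev x \<noteq> 0" using * by (metis mult_0_right)
  qed
  have zero: "block (3 * k) = k" "3 * k mod 3 = 0" for k by (simp_all add: block_def)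
  have zero_block: "3 * block x = x" "x \<noteq> 0 \<Longrightarrow> block x \<noteq> 0" if "x mod 3 = 0" for x
    using that unfolding block_def by presburger+
  define split where "split M = ((image_mset lev (res 1 M), image_mset lev (res 2 M)),
    image_mset block (res 0 M))" for M
  define join where "join = (\<lambda>((M, N), L). image_mset up M + image_mset dn N + image_mset ((*) 3) L)"
  have res_image: "res r (image_mset f M) = (if r = q then image_mset f M else {#})"
    if "\<And>x. x \<in># M \<Longrightarrow> f x mod 3 = q" for r q M and f :: "nat \<Rightarrow> nat"
    using that unfolding res_def by (induction M) auto
  have res_join: "res 1 (join ((M, N), L)) = image_mset up M"
      "res 2 (join ((M, N), L)) = image_mset dn N"
      "res 0 (join ((M, N), L)) = image_mset ((*) 3) L"
    if "0 \<notin># N" for M N L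
  proof -
    have "res r (join ((M, N), L)) = (if r = 1 then image_mset up M else {#}) +
      (if r = 2 then image_mset dn N else {#}) + (if r = 0 then image_mset ((*) 3) L else {#})" for r
    proof -
      have "dn x mod 3 = 2" if "x \<in># N" for x using dn(3) \<open>0 \<notin># N\<close> that by metis
      then show ?thesis
        using res_image[of M up 1 r] res_image[of N dn 2 r] res_image[of L "(*) 3" 0 r] up(3)
        by (simp add: join_def res_def)
    qed
    then show "res 1 (join ((M, N), L)) = image_mset up M"
      "res 2 (join ((M, N), L)) = image_mset dn N"
      "res 0 (join ((M, N), L)) = image_mset ((*) 3) L"
      by simp_all
  qed
  have split_join: "split (join ((M, N), L)) = ((M, N), L)" if "0 \<notin># N" for M N L
  proof -
    have "image_mset (\<lambda>x. lev (dn x)) N = image_mset (\<lambda>x. x) N"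
      by (rule image_mset_cong) (use dn(2) that in metis)
    then show ?thesis
      using res_join[OF that] by (simp add: split_def multiset.map_comp comp_def up zero)
  qed
  have res_sum: "M = res 1 M + res 2 M + res 0 M" for M
  proof (induction M)
    case (add x M)
    have "x mod 3 = 0 \<or> x mod 3 = 1 \<or> x mod 3 = 2" by presburger
    then show ?case using add unfolding res_def by auto
  qed (simp add: res_def)
  have join_split: "join (split M) = M" if "Q M" for M
  proof -
    have "image_mset (\<lambda>x. up (lev x)) (res 1 M) = image_mset (\<lambda>x. x) (res 1 M)"
      by (rule image_mset_cong) (use up_lev that in \<open>auto simp: Q_def res_def\<close>)
    moreover have "image_mset (\<lambda>x. dn (lev x)) (res 2 M) = image_mset (\<lambda>x. x) (res 2 M)"
      by (rule image_mset_cong) (use dn_lev that in \<open>auto simp: Q_def res_def\<close>)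
    moreover have "image_mset (\<lambda>x. 3 * block x) (res 0 M) = image_mset (\<lambda>x. x) (res 0 M)"
      by (rule image_mset_cong) (use zero_block in \<open>auto simp: res_def\<close>)
    ultimately show ?thesis
      using res_sum[of M] by (simp add: join_def split_def multiset.map_comp comp_def)
  qed
  have sum_block_join: "sum_mset (image_mset block (join ((M, N), L))) =
      d * (sum_mset M + sum_mset N) + sum_mset L" if "0 \<notin># N" for M N L
  proof -
    have "image_mset (\<lambda>x. block (dn x)) N = image_mset (\<lambda>x. d * x) N"
      by (rule image_mset_cong) (use dn(1) that in metis)
    then show ?thesis
      by (simp add: join_def multiset.map_comp comp_def up zero sum_mset_image_mult distrib_left)
  qed
  have Q_join: "Q (join ((M, N), L))" if "((M, N), L) \<in> ?R" for M N L
  proof -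
    have N: "0 \<notin># N" and L: "0 \<notin># L" and sz: "size M = a" "size N = b"
      and K: "d * (sum_mset M + sum_mset N) + sum_mset L = K"
      using that by (auto simp: bounded_pairs_def)
    have "x \<noteq> 0 \<and> (x mod 3 = 0 \<or> d dvd block x)" if x: "x \<in># join ((M, N), L)" for x
    proof -
      consider k where "x = up k" | k where "k \<in># N" "x = dn k" | k where "k \<in># L" "x = 3 * k"
        using x by (auto simp: join_def)
      then show ?thesis
      proof cases
        case 1
        then show ?thesis using up by simp
      next
        case 2
        then have "k \<noteq> 0" using N by metis
        then show ?thesis using 2 dn by simp
      next
        case 3
        then have "k \<noteq> 0" using L by metis
        then show ?thesis using 3 by simp
      qed
    qed
    moreover have "size (res 1 (join ((M, N), L))) = a" "size (res 2 (join ((M, N), L))) = b"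
      by (simp_all only: res_join[OF N] size_image_mset sz)
    ultimately show ?thesis
      unfolding Q_def using sum_block_join[OF N] K by metis
  qed
  have split_R: "split M \<in> ?R" if "Q M" for M
  proof -
    have "0 \<notin># image_mset lev (res 2 M)"
    proof
      assume "0 \<in># image_mset lev (res 2 M)"
      then obtain x where "lev x = 0" "x \<in># M" "x mod 3 = 2" by (auto simp: res_def)
      then show False using dn_lev(2)[of x] that by (auto simp: Q_def)
    qed
    moreover have "0 \<notin># image_mset block (res 0 M)"
    proof
      assume "0 \<in># image_mset block (res 0 M)"
      then obtain x where "block x = 0" "x \<in># M" "x mod 3 = 0" by (auto simp: res_def)
      then show False using zero_block(2)[of x] that by (cases "x = 0") (auto simp: Q_def)
    qed
    \<comment> \<open>The weight formula for \<open>join\<close> is applied to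
      \<open>join (split M) = M\<close>.\<close>
    moreover have "d * (sum_mset (image_mset lev (res 1 M)) + sum_mset (image_mset lev (res 2 M)))
        + sum_mset (image_mset block (res 0 M)) = K"
      using sum_block_join[OF calculation(1), of "image_mset lev (res 1 M)" "image_mset block (res 0 M)"]
        join_split[OF that] that by (simp add: split_def Q_def)
    ultimately show ?thesis using that by (simp add: split_def bounded_pairs_def Q_def)
  qed
  have "scaled_parts d a b K = {ps. sorted_wrt (\<ge>) ps \<and> Q (mset ps)}"
    by (auto simp: scaled_parts_def Q_def res_def num_parts_mod_def sum_mset_sum_list
        simp flip: mset_filter mset_map)
  then have "card (scaled_parts d a b K) = card {M. Q M}"
    by (simp add: card_desc_lists_mset)
  also have "\<dots> = card ?R"
  proof (rule bij_betw_same_card[where f = split], rule bij_betw_byWitness[where f' = join])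
    show "\<forall>M\<in>{M. Q M}. join (split M) = M" using join_split by simp
    show "\<forall>z\<in>?R. split (join z) = z" using split_join by (auto simp: bounded_pairs_def)
    show "split ` {M. Q M} \<subseteq> ?R" by (intro image_subsetI split_R) simp
    show "join ` ?R \<subseteq> {M. Q M}"
    proof (rule image_subsetI)
      fix z assume z: "z \<in> ?R"
      obtain M N L where "z = ((M, N), L)" by (metis surj_pair)
      then show "join z \<in> {M. Q M}" using Q_join z by (simp only: mem_Collect_eq)
    qed
  qed
  finally show ?thesis .
qed

lemma card_scaled_parts:
  assumes "0 < d"
  shows "card (scaled_parts d a b K) = (\<Sum>c | d * c \<le> K.
    card {s \<in> bounded_pairs a b. sum_mset (fst s) + sum_mset (snd s) = c} *
    card {M \<in> {M. 0 \<notin># M}. sum_mset M = K - d * c})"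
  unfolding card_scaled_parts_pairs[OF assms]
proof (rule card_weighted_pairs[OF assms])
  show "finite {s \<in> bounded_pairs a b. sum_mset (fst s) + sum_mset (snd s) = c}" for c
  proof (rule finite_subset)
    show "{s \<in> bounded_pairs a b. sum_mset (fst s) + sum_mset (snd s) = c} \<subseteq>
      {M. size M \<le> a \<and> sum_mset M \<le> c} \<times> {M. size M \<le> b \<and> sum_mset M \<le> c}"
      by (auto simp: bounded_pairs_def)
  qed (simp add: finite_multisets_sum_le)
  show "finite {M \<in> {M. 0 \<notin># M}. sum_mset M = j}" for j :: nat
    by (rule finite_subset[OF _ finite_multisets_sum_le[of j j]]) (use size_le_sum_mset in auto)
qed

section \<open>Cancelling the free partition at \<open>d = 1\<close>\<close>

text \<open>A partition of \<open>j\<close> has at most \<open>j\<close> parts, so after padding the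
  length \<open>N\<close> is no restriction.\<close>

lemma card_desc_lists_sum:
  assumes "j \<le> N"
  shows "card {p \<in> desc_lists N. sum_list p = j} = card {M \<in> {M. 0 \<notin># M}. sum_mset M = j}"
proof -
  have "card {p \<in> desc_lists N. sum_list p = j} =
      card {xs. sorted_wrt (\<ge>) xs \<and> length xs = N \<and> sum_list xs = j}"
    by (simp add: desc_lists_def conj_assoc)
  also have "\<dots> = card {ps. sorted_wrt (\<ge>) ps \<and> 0 \<notin> set ps \<and> sum_list ps = j}"
    using length_le_sum_list assms
    by (intro card_pad_zeros[symmetric]) (auto simp: sum_list_replicate intro: le_trans)
  also have "\<dots> = card {ps. sorted_wrt (\<ge>) ps \<and> (0 \<notin># mset ps \<and> sum_mset (mset ps) = j)}"
    by (simp add: sum_mset_sum_list)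
  also have "\<dots> = card {M. 0 \<notin># M \<and> sum_mset M = j}"
    by (rule card_desc_lists_mset)
  finally show ?thesis by simp
qed

lemma scaled_parts_1_eq: "scaled_parts 1 a b K = spaced_parts 1 a b K"
  using sorted_imp_spaced_1 by (auto simp: scaled_parts_def spaced_parts_def)

theorem card_scaled_parts_eq_spaced_parts:
  assumes "0 < d"
  shows "card (scaled_parts d a b K) = card (spaced_parts d a b K)"
proof -
  \<comment> \<open>One word length serves every \<open>k \<le> K\<close>, so that \<open>W\<close>
    is the same function in all the convolutions compared.\<close>
  define N where "N = 3 * K + a"
  define W where "W c = card {w \<in> words N a b. comaj w = c}" for c
  define R where "R c = card {s \<in> bounded_pairs a b. sum_mset (fst s) + sum_mset (snd s) = c}" for c
  define p where "p j = card {M \<in> {M :: nat multiset. 0 \<notin># M}. sum_mset M = j}" for j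
  have spaced: "card (spaced_parts e a b k) = (\<Sum>c | e * c \<le> k. W c * p (k - e * c))"
    if "0 < e" "k \<le> K" for e k
  proof -
    have "card {q \<in> desc_lists N. sum_list q = k - e * c} = p (k - e * c)" for c
      unfolding p_def by (rule card_desc_lists_sum) (use that in \<open>simp add: N_def\<close>)
    moreover have "3 * k + a \<le> N" using that by (simp add: N_def)
    ultimately show ?thesis
      using card_spaced_parts[OF that(1)] by (simp add: W_def)
  qed
  have scaled: "card (scaled_parts e a b k) = (\<Sum>c | e * c \<le> k. R c * p (k - e * c))"
    if "0 < e" for e k
    using card_scaled_parts[OF that] by (simp add: R_def p_def)
  have "{M \<in> {M :: nat multiset. 0 \<notin># M}. sum_mset M = 0} = {{#}}"
  proof -
    have "M = {#}" if "0 \<notin># M" "sum_mset M = 0" for M :: "nat multiset"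
      using size_le_sum_mset[OF that(1)] that(2) by simp
    then show ?thesis by auto
  qed
  then have p0: "p 0 = 1" by (simp add: p_def)
  \<comment> \<open>At jump 1 the two families coincide, so the convolutions of \<open>R\<close> and
    \<open>W\<close> with \<open>p\<close> agree up to \<open>K\<close>.\<close>
  have WR: "R c = W c" if "c \<le> K" for c
  proof (rule convolution_cancel[where p = p, OF p0 _ that])
    fix k assume "k \<le> K"
    have "{c. 1 * c \<le> k} = {..k}" by auto
    then show "(\<Sum>c\<le>k. R c * p (k - c)) = (\<Sum>c\<le>k. W c * p (k - c))"
      using spaced[of 1 k] scaled[of 1 k] \<open>k \<le> K\<close> scaled_parts_1_eq[of a b k] by simp
  qed
  \<comment> \<open>Every index with \<open>d * c \<le> K\<close> has \<open>c \<le> K\<close>, the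
    range in which \<open>R\<close> and \<open>W\<close> are known to agree.\<close>
  show ?thesis
    using spaced[OF assms order_refl] scaled[OF assms] WR le_of_mult_le[OF assms] by simp
qed

section \<open>Back to the conditions modulo 3 and modulo 6\<close>

lemma spaced_2_iff:
  assumes "sorted_wrt (\<ge>) ps" "0 \<notin> set ps"
  shows "(\<forall>j. Suc j < length ps \<longrightarrow>
            (ps!j = ps!(Suc j) + 1 \<longrightarrow> ps!(Suc j) mod 3 \<noteq> 1)
          \<and> (ps!j = ps!(Suc j) + 2 \<longrightarrow> ps!(Suc j) mod 3 = 2))
      \<and> 2 \<notin> set ps \<longleftrightarrow> spaced 2 ps"
  using assms
proof (induction ps)
  case (Cons x ps)
  \<comment> \<open>A part 2 has block 1 and letter 0. Spacing then leaves room only for another 2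
    below it, and the smallest such 2 would violate the spacing from the virtual part.\<close>
  have no2: "hd (xs @ [0]) \<noteq> 2" if "spaced 2 xs" for xs
    using that
  proof (induction xs)
    case (Cons y xs)
    show ?case
    proof
      assume "hd ((y # xs) @ [0]) = 2"
      then have y: "block y = 1" "letter y = 0" by (auto simp: block_def letter_def)
      let ?z = "hd (xs @ [0])"
      have "block ?z + 2 * of_bool (0 < letter ?z) \<le> 1" "?z \<noteq> 2"
        using Cons y by auto
      then show False using block_letter[of ?z]
        by (cases "letter ?z = 0"; cases "block ?z") auto
    qed
  qed simp
  show ?case
  proof (cases ps)
    case Nil
    \<comment> \<open>For a single part only the virtual part lies below: a part with letter 0 needs
      block at least 2, which excludes exactly 2.\<close>
    have "2 \<noteq> x \<longleftrightarrow> 2 * of_bool (letter x < 1) \<le> block x"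
      using Cons.prems unfolding letter_def block_def by (auto split: if_splits) presburger+
    then show ?thesis using Nil by simp
  next
    case (Cons y ys)
    have "y \<le> x" "0 < y" using Cons.prems \<open>ps = y # ys\<close> by auto
    have "y mod 3 = 1 \<longleftrightarrow> letter y = 2" "y mod 3 = 2 \<longleftrightarrow> letter y = 0"
      unfolding letter_def by presburger+
    moreover have "letter x = 0 \<or> letter x = 1 \<or> letter x = 2"
        "letter y = 0 \<or> letter y = 1 \<or> letter y = 2"
      using letter_le[of x] letter_le[of y] by auto
    \<comment> \<open>If the letter drops, \<open>y \<le> x\<close> forces the blocks to differ by
      at least 1. A difference of exactly 1 means x - y = 1 with \<open>letter y = 2\<close>, or x -
      y = 2 with \<open>letter y\<close> nonzero: the pairs excluded by (a) and (b).\<close>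
    ultimately have step: "(x = y + 1 \<longrightarrow> y mod 3 \<noteq> 1) \<and> (x = y + 2 \<longrightarrow> y mod 3 = 2) \<longleftrightarrow>
        block y + 2 * of_bool (letter x < letter y) \<le> block x"
      using block_letter[of x] block_letter[of y] \<open>y \<le> x\<close>
      by (elim disjE) (simp_all, presburger+)
    define P where "P u v \<longleftrightarrow> (u = v + 1 \<longrightarrow> v mod 3 \<noteq> 1) \<and> (u = v + 2 \<longrightarrow> v mod 3 = 2)"
      for u v :: nat
    have IH: "(\<forall>j. Suc j < length ps \<longrightarrow> P (ps ! j) (ps ! Suc j)) \<and> 2 \<notin> set ps \<longleftrightarrow> spaced 2 ps"
      unfolding P_def using Cons.prems by (intro Cons.IH) auto
    have "(\<forall>j. Suc j < length (x # ps) \<longrightarrow> P ((x # ps) ! j) ((x # ps) ! Suc j)) \<longleftrightarrow>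
        P x y \<and> (\<forall>j. Suc j < length ps \<longrightarrow> P (ps ! j) (ps ! Suc j))"
      unfolding \<open>ps = y # ys\<close> by (auto simp: nth_Cons split: nat.splits)
    moreover have "spaced 2 (x # ps) \<longleftrightarrow> P x y \<and> spaced 2 ps"
      using step \<open>ps = y # ys\<close> by (simp add: P_def)
    moreover have "x \<noteq> 2" if "spaced 2 (x # ps)"
      using no2[OF that] by simp
    ultimately show ?thesis
      using IH unfolding P_def[symmetric] by (metis list.set_intros(2) set_ConsD)
  qed
qed simp

theorem theorem3p3:
  fixes n m1 m2 :: nat
  shows "C1 m1 m2 n = C2 m1 m2 n"
proof -
  have part: "is_partition n ps \<longleftrightarrow> sorted_wrt (\<ge>) ps \<and> 0 \<notin> set ps \<and> sum_list ps = n" for ps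
    unfolding is_partition_def by (metis gr0I less_irrefl)
  have mod6: "x mod 6 \<in> {0, 1, 3, 5} \<longleftrightarrow> x mod 3 = 0 \<or> 2 dvd block x" for x
    unfolding block_def by simp presburger
  have num6: "num_parts_mod 6 1 ps = num_parts_mod 3 1 ps" "num_parts_mod 6 5 ps = num_parts_mod 3 2 ps"
    if "\<forall>x\<in>set ps. x mod 6 \<in> {0, 1, 3, 5}" for ps
  proof -
    have "x mod 6 = 1 \<longleftrightarrow> x mod 3 = 1" "x mod 6 = 5 \<longleftrightarrow> x mod 3 = 2"
      if "x mod 6 \<in> {0, 1, 3, 5}" for x :: nat
      using that by simp_all presburger+
    then show "num_parts_mod 6 1 ps = num_parts_mod 3 1 ps"
      "num_parts_mod 6 5 ps = num_parts_mod 3 2 ps"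
      using that unfolding num_parts_mod_def by (auto intro!: arg_cong[where f = length] filter_cong)
  qed
  let ?A = "{ps. is_partition n ps \<and> (\<forall>p\<in>set ps. p mod 6 \<in> {0, 1, 3, 5})
      \<and> num_parts_mod 6 1 ps = m1 \<and> num_parts_mod 6 5 ps = m2}"
  let ?B = "{ps. is_partition n ps
      \<and> (\<forall>j. Suc j < length ps \<longrightarrow>
            (ps!j = ps!(Suc j) + 1 \<longrightarrow> ps!(Suc j) mod 3 \<noteq> 1)
          \<and> (ps!j = ps!(Suc j) + 2 \<longrightarrow> ps!(Suc j) mod 3 = 2))
      \<and> 2 \<notin> set ps
      \<and> num_parts_mod 3 1 ps = m1 \<and> num_parts_mod 3 2 ps = m2}"
  have A: "?A = {ps. sorted_wrt (\<ge>) ps \<and> 0 \<notin> set ps \<and> (\<forall>x\<in>set ps. x mod 3 = 0 \<or> 2 dvd block x) \<and>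
      num_parts_mod 3 1 ps = m1 \<and> num_parts_mod 3 2 ps = m2 \<and> sum_list ps = n}"
    unfolding part mod6[symmetric] using num6 by (intro Collect_cong) metis
  have B: "?B = {ps. sorted_wrt (\<ge>) ps \<and> 0 \<notin> set ps \<and> spaced 2 ps \<and>
      num_parts_mod 3 1 ps = m1 \<and> num_parts_mod 3 2 ps = m2 \<and> sum_list ps = n}"
    unfolding part using spaced_2_iff by (intro Collect_cong) blast
  have "card ?A = card ?B"
  \<comment> \<open>Any list in either set yields such a \<open>K\<close>, namely its sum of blocks;
    without one both sets are empty.\<close>
  proof (cases "\<exists>K. n + m2 = 3 * K + m1")
    case True
    then obtain K where K: "n + m2 = 3 * K + m1" by blast
    have "sum_list ps = n \<longleftrightarrow> sum_list (map block ps) = K"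
      if "num_parts_mod 3 1 ps = m1" "num_parts_mod 3 2 ps = m2" for ps
      using sum_list_block_residues[of ps] that K by auto
    then have "?A = scaled_parts 2 m1 m2 K" "?B = spaced_parts 2 m1 m2 K"
      unfolding A B scaled_parts_def spaced_parts_def by (intro Collect_cong; blast)+
    then show ?thesis using card_scaled_parts_eq_spaced_parts[of 2] by simp
  next
    case False
    then have "?A = {}" "?B = {}"
      unfolding A B using sum_list_block_residues by blast+
    then show ?thesis by (simp only:)
  qed
  then show ?thesis unfolding C1_def C2_def .
qed

end
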